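(* For each integer $k\ge 0$, let $\mathcal{S}^1_k$ denote the set of positions with nim-value $1$ in the game $\mathcal{W}_k$. Then for every integer $k\ge 0$, $$\mathcal{S}^1_{k+2}=\{(0,1)\}\cup\{(a+2,b+2)\mid (a,b)\in \mathcal{S}^1_k\}.$$
   Context: For an integer $k\ge 0$, $\mathcal{W}_k$ is the following two-player game. A position is a pair $(a,b)$ of nonnegative integers (sizes of two piles of tokens); the piles are unordered, so $(a,b)$ and $(b,a)$ are identified, and a listed set of positions is understood up to this symmetry. Players alternate; a player who cannot move loses. Each move is one of: (i) remove a positive number of tokens from a single pile; (ii) remove an equal positive number of tokens from both piles, provided that neither pile has size less than $k$ after the move. ($\mathcal{W}_0$ is Wythoff's game.) The nim-value (Sprague-Grundy value) of a position is defined recursively as the least nonnegative integer that is not the nim-value of any position reachable from it in one move (so a terminal position has nim-value $0$). *)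

theory Defs
  imports "HOL-Library.Uprod"
begin

type_synonym position = "nat uprod"

text \<open>
  Since \<^term>\<open>Upair a b = Upair b a\<close>, rule \<open>single\<close> covers removal from either pile.
  In rule \<open>diagonal\<close> the sizes \<open>a\<close> and \<open>b\<close> compared with \<open>k\<close> are those left after the move.
\<close>

inductive move :: "nat \<Rightarrow> position \<Rightarrow> position \<Rightarrow> bool" for k :: nat where
  single: "0 < t \<Longrightarrow> move k (Upair (a + t) b) (Upair a b)"
| diagonal: "0 < t \<Longrightarrow> k \<le> a \<Longrightarrow> k \<le> b \<Longrightarrow> move k (Upair (a + t) (b + t)) (Upair a b)"

lift_definition tokens :: "position \<Rightarrow> nat" is "\<lambda>(a, b). a + b"
  by auto

lemma tokens_Upair [simp]: "tokens (Upair a b) = a + b"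
  by transfer simp

lemma move_tokens_less: "move k p q \<Longrightarrow> tokens q < tokens p"
  by (induction rule: move.induct) simp_all

text \<open>Meaningful for sets other than \<^term>\<open>UNIV\<close>; every position has only finitely many options.\<close>

definition mex :: "nat set \<Rightarrow> nat" where
  "mex A = (LEAST n. n \<notin> A)"

function nim_value :: "nat \<Rightarrow> position \<Rightarrow> nat" where
  "nim_value k p = mex (nim_value k ` {q. move k p q})"
  by pat_completeness auto
termination
  by (relation "measure (\<lambda>(k, p). tokens p)") (auto simp: move_tokens_less)

declare nim_value.simps [simp del]

definition S1 :: "nat \<Rightarrow> position set" where
  "S1 k = {p. nim_value k p = 1}"

end

theory Submission
  imports Defs
begin

text \<open>
  Call a set \<open>A\<close> of positions the kernel at level \<open>n\<close> if its members have nim-value at least \<open>n\<close>,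
  no move joins two of its members, and every other position of nim-value at least \<open>n\<close> has a move
  into \<open>A\<close>. Since moves decrease the number of tokens, there is only one such set, namely the set
  of positions of nim-value \<open>n\<close> (\<open>nim_value_eq_iff_mem_kernel\<close>). So it suffices to check that the
  proposed sets are kernels.

  Both checks rest on the same two observations. Adding \<open>m\<close> tokens to each pile turns the moves
  of the game with parameter \<open>k\<close> into exactly those moves of the game with parameter \<open>k + m\<close>
  that leave at least \<open>m\<close> tokens in each pile (\<open>move_shift_iff\<close>). And from a position with both
  piles of size at least \<open>m\<close>, no move can make both piles smaller than \<open>m\<close>, because a single
  pile removal leaves the other pile alone and a diagonal move leaves at least \<open>k + m\<close> in each.
  Hence shifted kernel positions interact with each other as before, and never reach the new small
  positions; only those positions with a pile smaller than \<open>m\<close> remain to be dominated.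

  At level 0 take \<open>m = 1\<close>: the single new position \<open>(0,0)\<close> dominates every \<open>(0,b)\<close> with
  \<open>b > 0\<close>. Two such steps show that the zero positions for \<open>k + 2\<close> are \<open>(0,0)\<close>, \<open>(1,1)\<close> and the
  zero positions for \<open>k\<close> shifted by 2. At level 1 take \<open>m = 2\<close>: the new position \<open>(0,1)\<close> dominates
  every \<open>(0,b)\<close> and \<open>(1,b)\<close> with \<open>b \<ge> 2\<close>, and what is left over, \<open>(0,0)\<close> and \<open>(1,1)\<close>, has
  nim-value 0.
\<close>

section \<open>Nim-values and kernels\<close>

lemma finite_tokens_less: "finite {q. tokens q < n}"
proof (rule finite_subset)
  show "{q. tokens q < n} \<subseteq> (\<lambda>(a, b). Upair a b) ` ({..<n} \<times> {..<n})"
  proof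
    fix q
    assume "q \<in> {q. tokens q < n}"
    moreover obtain a b where "q = Upair a b"
      by (cases q) auto
    ultimately show "q \<in> (\<lambda>(a, b). Upair a b) ` ({..<n} \<times> {..<n})"
      by (auto intro!: image_eqI[of _ _ "(a, b)"])
  qed
qed simp

lemma finite_moves: "finite {q. move k p q}"
  by (rule finite_subset[OF _ finite_tokens_less[of "tokens p"]]) (auto dest: move_tokens_less)

lemma mex_notin:
  assumes "finite A"
  shows "mex A \<notin> A"
  unfolding mex_def using LeastI_ex[OF ex_new_if_finite[OF _ assms]] by simp

lemma less_mex_in: "n < mex A \<Longrightarrow> n \<in> A"
  unfolding mex_def using not_less_Least by blast

lemma nim_value_move_neq: "move k p q \<Longrightarrow> nim_value k q \<noteq> nim_value k p"
  using mex_notin[OF finite_imageI[OF finite_moves], of "nim_value k" k p]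
  by (subst (asm) (1) nim_value.simps[symmetric]) (metis image_eqI mem_Collect_eq)

lemma less_nim_value_option:
  assumes "n < nim_value k p"
  shows "\<exists>q. move k p q \<and> nim_value k q = n"
proof -
  have "n \<in> nim_value k ` {q. move k p q}"
    using assms by (intro less_mex_in) (simp add: nim_value.simps[of k p])
  then show ?thesis
    by blast
qed

lemma nim_value_eq_iff:
  "nim_value k p = n \<longleftrightarrow> n \<le> nim_value k p \<and> (\<forall>q. move k p q \<longrightarrow> nim_value k q \<noteq> n)"
  using nim_value_move_neq less_nim_value_option by (metis le_neq_implies_less order_refl)

text \<open>
  By induction on the number of tokens, the options in \<open>A\<close> are exactly those of nim-value \<open>n\<close>;
  among positions of nim-value at least \<open>n\<close>, having no option of nim-value \<open>n\<close> then characterises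
  both the value \<open>n\<close> and membership in \<open>A\<close>.
\<close>

lemma nim_value_eq_iff_mem_kernel:
  assumes level: "\<And>p. p \<in> A \<Longrightarrow> n \<le> nim_value k p"
    and independent: "\<And>p q. p \<in> A \<Longrightarrow> move k p q \<Longrightarrow> q \<notin> A"
    and absorbing: "\<And>p. n \<le> nim_value k p \<Longrightarrow> p \<notin> A \<Longrightarrow> \<exists>q\<in>A. move k p q"
  shows "nim_value k p = n \<longleftrightarrow> p \<in> A"
proof (induction p rule: measure_induct_rule[of tokens])
  case (less p)
  then have "move k p q \<Longrightarrow> nim_value k q = n \<longleftrightarrow> q \<in> A" for q
    by (simp add: move_tokens_less)
  then show ?case
    using level independent absorbing nim_value_eq_iff[of k p n] by blast
qed

section \<open>Moves and shifted positions\<close>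

text \<open>
  Case analysis on an unordered pair produces both orders of its components. Fixing one
  representative \<open>(x, y)\<close> of the starting position and describing the target by the removed tokens
  settles the symmetry once and lets later arguments compare sizes componentwise.
\<close>

lemma move_Upair_iff:
  "move k (Upair x y) q \<longleftrightarrow>
    (\<exists>x'<x. q = Upair x' y) \<or> (\<exists>y'<y. q = Upair x y') \<or>
    (\<exists>t>0. k + t \<le> x \<and> k + t \<le> y \<and> q = Upair (x - t) (y - t))"
  (is "_ \<longleftrightarrow> ?rhs")
proof
  assume "move k (Upair x y) q"
  then show ?rhs
  proof cases
    case (single t a b)
    then have "x = a + t \<and> y = b \<or> x = b \<and> y = a + t"
      by simp
    then show ?thesis
    proof
      assume "x = a + t \<and> y = b"
      then have "a < x" "q = Upair a y"
        using single by auto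
      then show ?thesis by blast
    next
      assume "x = b \<and> y = a + t"
      then have "a < y" "q = Upair x a"
        using single by auto
      then show ?thesis by blast
    qed
  next
    case (diagonal t a b)
    then have "x = a + t \<and> y = b + t \<or> x = b + t \<and> y = a + t"
      by simp
    then have "q = Upair (x - t) (y - t)" "k + t \<le> x" "k + t \<le> y"
      using diagonal by auto
    then show ?thesis
      using diagonal(3) by blast
  qed
next
  have left: "move k (Upair x y) (Upair x' y)" if "x' < x" for x x' y
    using move.single[of "x - x'" k x' y] that by simp
  have right: "move k (Upair x y) (Upair x y')" if "y' < y" for y'
    using left[OF that, of x] by (metis Upair_inject)
  have both: "move k (Upair x y) (Upair (x - t) (y - t))" if "0 < t" "k + t \<le> x" "k + t \<le> y" for t
    using move.diagonal[of t k "x - t" "y - t"] that by simp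
  assume ?rhs
  then show "move k (Upair x y) q"
    using left right both by blast
qed

text \<open>
  A move is determined by how much it removes from which piles; adding \<open>m\<close> to both piles and to
  the lower bound for diagonal moves changes neither.
\<close>

lemma move_shift_iff:
  "move (k + m) (Upair (a + m) (b + m)) (Upair (c + m) (d + m)) \<longleftrightarrow>
    move k (Upair a b) (Upair c d)"
proof -
  have diagonal: "k + m + t \<le> a + m \<and> k + m + t \<le> b + m \<and>
        Upair (c + m) (d + m) = Upair (a + m - t) (b + m - t) \<longleftrightarrow>
      k + t \<le> a \<and> k + t \<le> b \<and> Upair c d = Upair (a - t) (b - t)" for t
    unfolding Upair_inject by linarith
  have first: "(\<exists>x'<a + m. Upair (c + m) (d + m) = Upair x' (b + m)) \<longleftrightarrow>
      (\<exists>x'<a. Upair c d = Upair x' b)"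
    by (auto intro: exI[of _ "c + m"] exI[of _ "d + m"])
  have second: "(\<exists>y'<b + m. Upair (c + m) (d + m) = Upair (a + m) y') \<longleftrightarrow>
      (\<exists>y'<b. Upair c d = Upair a y')"
    by (auto intro: exI[of _ "c + m"] exI[of _ "d + m"])
  show ?thesis
    by (simp only: move_Upair_iff first second diagonal)
qed

section \<open>Positions of nim-value zero\<close>

text \<open>
  Raising the parameter by 1 suffices to cut \<open>(0,0)\<close> off from all positions with two nonempty piles:
  it could only be reached from them diagonally, which would leave piles smaller than \<open>Suc k\<close>.
  Thus \<open>(0,0)\<close> answers exactly the positions that are not shifts, other than itself.
\<close>

lemma nim_value_Suc_eq_0_iff:
  "nim_value (Suc k) p = 0 \<longleftrightarrow>
    p \<in> {Upair 0 0} \<union> {Upair (Suc a) (Suc b) | a b. nim_value k (Upair a b) = 0}"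
  (is "_ \<longleftrightarrow> p \<in> ?A")
proof (rule nim_value_eq_iff_mem_kernel)
  fix p q
  assume p: "p \<in> ?A" and move: "move (Suc k) p q"
  show "q \<notin> ?A"
  proof
    assume q: "q \<in> ?A"
    from p move obtain a b where ab: "p = Upair (Suc a) (Suc b)" "nim_value k (Upair a b) = 0"
      by (auto simp: move_Upair_iff)
    from q move ab(1) obtain c d where
      cd: "q = Upair (Suc c) (Suc d)" "nim_value k (Upair c d) = 0"
      by (auto simp: move_Upair_iff)
    have "move k (Upair a b) (Upair c d)"
      using move ab(1) cd(1) move_shift_iff[of k 1] by simp
    then show False
      using nim_value_move_neq ab(2) cd(2) by metis
  qed
next
  fix p
  assume p: "p \<notin> ?A"
  obtain x y where xy: "p = Upair x y"
    by (cases p) auto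
  show "\<exists>q\<in>?A. move (Suc k) p q"
  proof (cases "x = 0 \<or> y = 0")
    case True
    then have "move (Suc k) p (Upair 0 0)"
      using p xy by (auto simp: move_Upair_iff)
    then show ?thesis by blast
  next
    case False
    then obtain a b where ab: "x = Suc a" "y = Suc b"
      by (metis not0_implies_Suc)
    with p xy have "0 < nim_value k (Upair a b)"
      by auto
    then obtain q where "move k (Upair a b) q" "nim_value k q = 0"
      using less_nim_value_option by blast
    moreover obtain c d where "q = Upair c d"
      by (cases q) auto
    ultimately show ?thesis
      using move_shift_iff[of k 1 a b c d] xy ab by auto
  qed
qed simp

lemma nim_value_Suc_Upair_0_eq_0_iff: "nim_value (Suc k) (Upair 0 b) = 0 \<longleftrightarrow> b = 0"
  by (auto simp: nim_value_Suc_eq_0_iff)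

lemma nim_value_Suc_shift_eq_0_iff:
  "nim_value (Suc k) (Upair (Suc a) (Suc b)) = 0 \<longleftrightarrow> nim_value k (Upair a b) = 0"
proof -
  have swap: "Upair b a = Upair a b"
    by simp
  show ?thesis
    unfolding nim_value_Suc_eq_0_iff by (auto simp: swap)
qed

section \<open>Positions of nim-value one\<close>

text \<open>
  The shift is by 2 because at level 1 the positions with a pile smaller than 2 are answered by the
  single position \<open>(0,1)\<close>, apart from \<open>(0,0)\<close> and \<open>(1,1)\<close>, which have nim-value 0; the zero
  positions must therefore be followed through the same shift, by using the previous step twice.
\<close>

theorem theorem7:
  fixes k :: nat
  shows "S1 (k + 2) = {Upair 0 1} \<union> {Upair (a + 2) (b + 2) | a b. Upair a b \<in> S1 k}"
proof -
  let ?A = "{Upair 0 1} \<union> {Upair (a + 2) (b + 2) | a b. nim_value k (Upair a b) = 1}"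
  have zero_shift: "nim_value (k + 2) (Upair (a + 2) (b + 2)) = 0 \<longleftrightarrow> nim_value k (Upair a b) = 0"
    for a b
    by (simp add: nim_value_Suc_shift_eq_0_iff)
  have zero_small: "nim_value (k + 2) (Upair 0 0) = 0" "nim_value (k + 2) (Upair 1 1) = 0"
    "nim_value (k + 2) (Upair 0 1) \<noteq> 0"
    by (simp_all add: nim_value_Suc_shift_eq_0_iff nim_value_Suc_Upair_0_eq_0_iff)
  have "nim_value (k + 2) p = 1 \<longleftrightarrow> p \<in> ?A" for p
  proof (rule nim_value_eq_iff_mem_kernel)
    fix p
    assume "p \<in> ?A"
    then consider "p = Upair 0 1"
      | a b where "p = Upair (a + 2) (b + 2)" "nim_value k (Upair a b) = 1"
      by blast
    then have "nim_value (k + 2) p \<noteq> 0"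
    proof cases
      case 1
      then show ?thesis
        using zero_small(3) by simp
    next
      case (2 a b)
      then show ?thesis
        using zero_shift[of a b] by simp
    qed
    then show "1 \<le> nim_value (k + 2) p"
      by simp
  next
    fix p q
    assume p: "p \<in> ?A" and move: "move (k + 2) p q"
    show "q \<notin> ?A"
    proof
      assume q: "q \<in> ?A"
      from p q move obtain a b where
        ab: "p = Upair (a + 2) (b + 2)" "nim_value k (Upair a b) = 1"
        by (auto simp: move_Upair_iff)
      from q move ab(1) obtain c d where
        cd: "q = Upair (c + 2) (d + 2)" "nim_value k (Upair c d) = 1"
        by (auto simp: move_Upair_iff)
      have "move k (Upair a b) (Upair c d)"
        using move unfolding ab(1) cd(1) move_shift_iff .
      then show False
        using nim_value_move_neq ab(2) cd(2) by metis
    qed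
  next
    fix p
    assume nonzero: "1 \<le> nim_value (k + 2) p" and p: "p \<notin> ?A"
    obtain x y where xy: "p = Upair x y"
      by (cases p) auto
    show "\<exists>q\<in>?A. move (k + 2) p q"
    proof (cases "2 \<le> x \<and> 2 \<le> y")
      case False
      have "move (k + 2) p (Upair 0 1)" if "x < 2" "p = Upair x y" for x y
      proof -
        have x: "x = 0 \<or> x = 1"
          using that(1) by auto
        \<comment> \<open>The pairs of smaller sizes are \<open>(0,0)\<close> and \<open>(1,1)\<close>, of nim-value 0, and \<open>(0,1)\<close>.\<close>
        have "2 \<le> y"
        proof (rule ccontr)
          assume "\<not> 2 \<le> y"
          then have "y = 0 \<or> y = 1"
            by auto
          with x have "p = Upair 0 0 \<or> p = Upair 1 1 \<or> p = Upair 0 1"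
            using that(2) by auto
          with nonzero p zero_small show False
            by auto
        qed
        with x show ?thesis
          unfolding that(2) move_Upair_iff by auto
      qed
      then have "move (k + 2) p (Upair 0 1)"
        using False xy Upair_inject[of x y y x] by (auto simp: not_le)
      then show ?thesis by blast
    next
      case True
      then obtain a b where ab: "x = a + 2" "y = b + 2"
        by (metis le_add_diff_inverse2)
      have "nim_value k (Upair a b) \<noteq> 0" "nim_value k (Upair a b) \<noteq> 1"
        using nonzero p zero_shift[of a b] unfolding xy ab by fastforce+
      then obtain q where q: "move k (Upair a b) q" "nim_value k q = 1"
        using less_nim_value_option[of 1 k "Upair a b"] by auto
      obtain c d where cd: "q = Upair c d"
        by (cases q) auto
      have "move (k + 2) p (Upair (c + 2) (d + 2))"
        using q(1) unfolding xy ab cd move_shift_iff .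
      then show ?thesis
        using q(2) cd by blast
    qed
  qed
  then show ?thesis
    unfolding S1_def by auto
qed

end
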